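(* Let $\mathsf N=\{p_1,\dots,p_n\}\subseteq\mathsf{Prop}$. (i) Every formula $\phi(\mathsf N)$ of $\mathbf{CPL}(\subseteq_0)$ and of $\mathbf{CPL}(\subseteq)$ is semantically equivalent to a formula of the form $\bigvee_{X\in\mathcal X}(\Theta_X\wedge\Phi_X)$ for some collection $\mathcal X$ of $\mathsf N$-teams. (ii) Every formula $\phi(\mathsf N)$ of $\mathbf{CPL}(\neq(\cdot))$ and of $\mathbf{CPL}(\Upsilon)$ is semantically equivalent to a formula of the form $\bigvee_{X\in\mathcal X}\psi_X$ for some collection $\mathcal X$ of $\mathsf N$-teams.
   Context: Fix a set $\mathsf{Prop}$ of propositional variables. Classical formulas: $\alpha::=p\mid\bot\mid\top\mid\neg\alpha\mid(\alpha\wedge\alpha)\mid(\alpha\vee\alpha)$ with $p\in\mathsf{Prop}$. For $\mathsf N\subseteq\mathsf{Prop}$, a valuation on $\mathsf N$ is a function $v:\mathsf N\cup\{\bot,\top\}\to\{0,1\}$ with $v(\bot)=0$, $v(\top)=1$; $2^{\mathsf N}$ is the set of all of them. An $\mathsf N$-team is a set $X\subseteq 2^{\mathsf N}$, with domain $\mathsf{dom}(X)=\mathsf N$ (the empty set is a team of any domain). For a sequence $\mathsf a=a_1\dots a_k$ write $v(\mathsf a)=\langle v(a_1),\dots,v(a_k)\rangle$. $\mathsf{Prop}(\phi)$ is the set of variables occurring in $\phi$, and $\phi(\mathsf N)$ indicates $\mathsf{Prop}(\phi)\subseteq\mathsf N$. Languages: each logic below is closed under $\wedge$ and $\vee$,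 contains $p,\bot,\top$ and $\neg\alpha$ for classical $\alpha$ only, and in addition has: $\mathbf{CPL}(\subseteq)$: inclusion atoms $a_1\dots a_k\subseteq b_1\dots b_k$ with $a_i,b_i\in\mathsf{Prop}\cup\{\bot,\top\}$; $\mathbf{CPL}(\subseteq_0)$: only primitive inclusion atoms $x_1\dots x_k\subseteq a_1\dots a_k$ with $x_i\in\{\bot,\top\}$, $a_i\in\mathsf{Prop}\cup\{\bot,\top\}$; $\mathbf{CPL}(\Upsilon)$: anonymity atoms $p_1\dots p_k\Upsilon q_1\dots q_m$ with $p_i,q_j\in\mathsf{Prop}$ (sequences may be empty); $\mathbf{CPL}(\neq(\cdot))$: only inconstancy atoms $\neq(p)$, $p\in\mathsf{Prop}$, where $\neq(p)$ is $\langle\rangle\Upsilon p$ with empty left sequence. Team semantics, for $X$ with $\mathsf{dom}(X)\supseteq\mathsf{Prop}(\phi)$: $X\models p$ iff $v(p)=1$ for all $v\in X$; $X\models\bot$ iff $X=\emptyset$; $X\models\top$ always; $X\models\neg\alpha$ iff $\{v\}\not\models\alpha$ for all $v\in X$; $X\models\phi\wedge\psi$ iff $X\models\phi$ and $X\models\psi$; $X\models\phi\vee\psi$ iff there are $Y,Z\subseteq X$ with $X=Y\cup Z$, $Y\models\phi$, $Z\models\psi$; $X\models\mathsf a\subseteq\mathsf b$ iff for all $v\in X$ there is $u\in X$ with $v(\mathsf a)=u(\mathsf b)$; $X\models\mathsf p\Upsilon\mathsf q$ iff for all $v\in X$ there is $u\in X$ with $v(\mathsf p)=u(\mathsf p)$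 and $v(\mathsf q)\neq u(\mathsf q)$. Semantic equivalence $\phi\equiv\psi$: satisfied by the same teams among those whose domain contains $\mathsf{Prop}(\phi)\cup\mathsf{Prop}(\psi)$. Notation: for $v\in 2^{\mathsf N}$ write $v(i)=v(p_i)$; $p_i^1:=p_i$, $p_i^0:=\neg p_i$; $\underline 0:=\bot$, $\underline 1:=\top$; $\bigvee\emptyset:=\bot$, $\bigwedge\emptyset:=\top$. For an $\mathsf N$-team $X$: $$\Theta_X:=\bigvee_{v\in X}(p_1^{v(1)}\wedge\dots\wedge p_n^{v(n)}),\qquad \Phi_X:=\bigwedge_{v\in X}\underline{v(1)}\dots\underline{v(n)}\subseteq p_1\dots p_n.$$ $\psi_\emptyset:=\bot$, and for $X\neq\emptyset$, $\psi_X:=\psi_X^{n}$, where for nonempty $X$ and $1\le k\le n$ the formula $\psi_X^{k}$ in the variables $p_1,\dots,p_k$ is defined by recursion on $k$ as follows. Put $X^+=\{v\in X: v(p_k)=1\}$, $X^-=\{v\in X: v(p_k)=0\}$. For $k=1$: $\psi_X^1:=\neg p_1$ if $X^+=\emptyset$; $\psi_X^1:=p_1$ if $X^-=\emptyset$; $\psi_X^1:=(p_1\vee\neg p_1)\wedge\neq(p_1)$ otherwise. For $k=m+1>1$: $\psi_X^{m+1}:=\psi_{X^-}^{m}\wedge\neg p_{m+1}$ if $X^+=\emptyset$; $\psi_X^{m+1}:=\psi_{X^+}^{m}\wedge p_{m+1}$ if $X^-=\emptyset$; and $\psi_X^{m+1}:=\big((\psi_{X^+}^{m}\wedge p_{m+1})\vee(\psi_{X^-}^{m}\wedge\neg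 p_{m+1})\big)\wedge\neq(p_{m+1})$ otherwise. *)

theory Defs
  imports "HOL-Library.FuncSet"
begin

text \<open>The set of propositional variables is the (arbitrary) type \<open>'p\<close>.
  Entries of inclusion atoms are variables or constants.\<close>

datatype 'p entry = EVar 'p | EBot | ETop

text \<open>One common syntax for all the logics; \<open>classical\<close> and \<open>language\<close> below carve out the
  formulas that are actually admitted. In particular \<open>Neg\<close> is only ever applied to classical
  formulas, and both sequences of an inclusion atom must have the same length.\<close>

datatype 'p form =
    Var 'p
  | Bot
  | Top
  | Neg "'p form"
  | And "'p form" "'p form"
  | Or "'p form" "'p form"
  | Incl "'p entry list" "'p entry list"
  | Anon "'p list" "'p list"

abbreviation Inconst :: "'p \<Rightarrow> 'p form" where
  "Inconst p \<equiv> Anon [] [p]"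

inductive_set classical :: "'p form set" where
  "Var p \<in> classical"
| "Bot \<in> classical"
| "Top \<in> classical"
| "\<alpha> \<in> classical \<Longrightarrow> Neg \<alpha> \<in> classical"
| "\<alpha> \<in> classical \<Longrightarrow> \<beta> \<in> classical \<Longrightarrow> And \<alpha> \<beta> \<in> classical"
| "\<alpha> \<in> classical \<Longrightarrow> \<beta> \<in> classical \<Longrightarrow> Or \<alpha> \<beta> \<in> classical"

text \<open>\<open>language A\<close> is the team logic whose additional atoms are those in \<open>A\<close>.\<close>

inductive_set language :: "'p form set \<Rightarrow> 'p form set" for A where
  "Var p \<in> language A"
| "Bot \<in> language A"
| "Top \<in> language A"
| "\<alpha> \<in> classical \<Longrightarrow> Neg \<alpha> \<in> language A"
| "\<phi> \<in> A \<Longrightarrow> \<phi> \<in> language A"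
| "\<phi> \<in> language A \<Longrightarrow> \<psi> \<in> language A \<Longrightarrow> And \<phi> \<psi> \<in> language A"
| "\<phi> \<in> language A \<Longrightarrow> \<psi> \<in> language A \<Longrightarrow> Or \<phi> \<psi> \<in> language A"

definition CPL_incl :: "'p form set" where
  "CPL_incl = language {Incl as bs | as bs. length as = length bs}"

definition CPL_incl0 :: "'p form set" where
  "CPL_incl0 = language {Incl xs as | xs as. length xs = length as \<and> set xs \<subseteq> {EBot, ETop}}"

definition CPL_anon :: "'p form set" where
  "CPL_anon = language {Anon ps qs | ps qs. True}"

definition CPL_inconst :: "'p form set" where
  "CPL_inconst = language {Inconst p | p. True}"

primrec props_entry :: "'p entry \<Rightarrow> 'p set" where
  "props_entry (EVar p) = {p}"
| "props_entry EBot = {}"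
| "props_entry ETop = {}"

primrec props :: "'p form \<Rightarrow> 'p set" where
  "props (Var p) = {p}"
| "props Bot = {}"
| "props Top = {}"
| "props (Neg \<phi>) = props \<phi>"
| "props (And \<phi> \<psi>) = props \<phi> \<union> props \<psi>"
| "props (Or \<phi> \<psi>) = props \<phi> \<union> props \<psi>"
| "props (Incl as bs) = (\<Union>a\<in>set as \<union> set bs. props_entry a)"
| "props (Anon ps qs) = set ps \<union> set qs"

text \<open>Valuations on \<open>N\<close> are extensional functions (constantly \<open>undefined\<close> outside \<open>N\<close>), so that
  distinct elements of \<open>valuations N\<close> differ on \<open>N\<close>; their fixed values at the constants are
  supplied by \<open>entry_val\<close>. Note that \<open>{}\<close> is an \<open>N\<close>-team for every \<open>N\<close>.\<close>

type_synonym 'p valuation = "'p \<Rightarrow> bool"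

definition valuations :: "'p set \<Rightarrow> 'p valuation set" where
  "valuations N = (N \<rightarrow>\<^sub>E UNIV)"

definition team :: "'p set \<Rightarrow> 'p valuation set \<Rightarrow> bool" where
  "team N X \<longleftrightarrow> X \<subseteq> valuations N"

primrec entry_val :: "'p valuation \<Rightarrow> 'p entry \<Rightarrow> bool" where
  "entry_val v (EVar p) = v p"
| "entry_val v EBot = False"
| "entry_val v ETop = True"

text \<open>Satisfaction is a total function, but is meaningful only for teams whose domain
  includes all variables of the formula.\<close>

primrec sat :: "'p form \<Rightarrow> 'p valuation set \<Rightarrow> bool" where
  "sat (Var p) X \<longleftrightarrow> (\<forall>v\<in>X. v p)"
| "sat Bot X \<longleftrightarrow> X = {}"
| "sat Top X \<longleftrightarrow> True"
| "sat (Neg \<alpha>) X \<longleftrightarrow> (\<forall>v\<in>X. \<not> sat \<alpha> {v})"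
| "sat (And \<phi> \<psi>) X \<longleftrightarrow> sat \<phi> X \<and> sat \<psi> X"
| "sat (Or \<phi> \<psi>) X \<longleftrightarrow> (\<exists>Y Z. Y \<subseteq> X \<and> Z \<subseteq> X \<and> X = Y \<union> Z \<and> sat \<phi> Y \<and> sat \<psi> Z)"
| "sat (Incl as bs) X \<longleftrightarrow> (\<forall>v\<in>X. \<exists>u\<in>X. map (entry_val v) as = map (entry_val u) bs)"
| "sat (Anon ps qs) X \<longleftrightarrow> (\<forall>v\<in>X. \<exists>u\<in>X. map v ps = map u ps \<and> map v qs \<noteq> map u qs)"

definition sem_equiv :: "'p form \<Rightarrow> 'p form \<Rightarrow> bool" where
  "sem_equiv \<phi> \<psi> \<longleftrightarrow>
     (\<forall>D X. props \<phi> \<union> props \<psi> \<subseteq> D \<longrightarrow> team D X \<longrightarrow> (sat \<phi> X \<longleftrightarrow> sat \<psi> X))"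

fun conj_list :: "'p form list \<Rightarrow> 'p form" where
  "conj_list [] = Top"
| "conj_list [\<phi>] = \<phi>"
| "conj_list (\<phi> # \<psi> # \<chi>s) = And \<phi> (conj_list (\<psi> # \<chi>s))"

fun disj_list :: "'p form list \<Rightarrow> 'p form" where
  "disj_list [] = Bot"
| "disj_list [\<phi>] = \<phi>"
| "disj_list (\<phi> # \<psi> # \<chi>s) = Or \<phi> (disj_list (\<psi> # \<chi>s))"

text \<open>Conjunctions and disjunctions indexed by a finite set, taken in an arbitrarily chosen
  order; nothing is guaranteed for infinite index sets.\<close>

definition list_of :: "'a set \<Rightarrow> 'a list" where
  "list_of A = (SOME xs. distinct xs \<and> set xs = A)"

definition Conj :: "'a set \<Rightarrow> ('a \<Rightarrow> 'p form) \<Rightarrow> 'p form" where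
  "Conj A f = conj_list (map f (list_of A))"

definition Disj :: "'a set \<Rightarrow> ('a \<Rightarrow> 'p form) \<Rightarrow> 'p form" where
  "Disj A f = disj_list (map f (list_of A))"

definition lit :: "'p \<Rightarrow> bool \<Rightarrow> 'p form" where
  "lit p b = (if b then Var p else Neg (Var p))"

definition const :: "bool \<Rightarrow> 'p entry" where
  "const b = (if b then ETop else EBot)"

text \<open>In the following, the variables of the domain are \<open>p 1, \<dots>, p n\<close>;
  other values of \<open>p\<close> are irrelevant.\<close>

definition Theta :: "(nat \<Rightarrow> 'p) \<Rightarrow> nat \<Rightarrow> 'p valuation set \<Rightarrow> 'p form" where
  "Theta p n X = Disj X (\<lambda>v. conj_list (map (\<lambda>i. lit (p i) (v (p i))) [1..<Suc n]))"

definition Phi :: "(nat \<Rightarrow> 'p) \<Rightarrow> nat \<Rightarrow> 'p valuation set \<Rightarrow> 'p form" where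
  "Phi p n X = Conj X (\<lambda>v. Incl (map (\<lambda>i. const (v (p i))) [1..<Suc n])
                                (map (\<lambda>i. EVar (p i)) [1..<Suc n]))"

text \<open>The recursion starts at \<open>k = 1\<close>; the clause for \<open>k = 0\<close> (the empty conjunction) only
  serves the degenerate domain without variables. The teams \<open>{v \<in> X. v q}\<close> and
  \<open>{v \<in> X. \<not> v q}\<close> are not restricted to \<open>p 1, \<dots>, p m\<close> in the recursive calls, since
  \<open>psi_rec p m\<close> inspects no other variables.\<close>

fun psi_rec :: "(nat \<Rightarrow> 'p) \<Rightarrow> nat \<Rightarrow> 'p valuation set \<Rightarrow> 'p form" where
  "psi_rec p 0 X = Top"
| "psi_rec p (Suc 0) X =
     (let q = p 1; Xp = {v \<in> X. v q}; Xm = {v \<in> X. \<not> v q} in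
      if Xp = {} then Neg (Var q)
      else if Xm = {} then Var q
      else And (Or (Var q) (Neg (Var q))) (Inconst q))"
| "psi_rec p (Suc (Suc l)) X =
     (let m = Suc l; q = p (Suc m); Xp = {v \<in> X. v q}; Xm = {v \<in> X. \<not> v q} in
      if Xp = {} then And (psi_rec p m Xm) (Neg (Var q))
      else if Xm = {} then And (psi_rec p m Xp) (Var q)
      else And (Or (And (psi_rec p m Xp) (Var q)) (And (psi_rec p m Xm) (Neg (Var q))))
               (Inconst q))"

definition psi :: "(nat \<Rightarrow> 'p) \<Rightarrow> nat \<Rightarrow> 'p valuation set \<Rightarrow> 'p form" where
  "psi p n X = (if X = {} then Bot else psi_rec p n X)"

end

theory Submission
  imports Defs
begin

text \<open>
  The satisfaction relation has three properties that hold for every formula: it depends only on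
  the values that the valuations of a team take at the variables of the formula
  (\<open>sat_cong_image\<close>), the empty team satisfies everything (\<open>sat_empty\<close>), and the satisfying teams
  are closed under unions (\<open>sat_Union\<close>). Hence a formula over \<open>N\<close> is determined by the collection
  \<open>\<X>\<close> of \<open>N\<close>-teams that satisfy it, and \<open>\<X>\<close> consists of the unions of its own subcollections.

  Both normal forms are built from characteristic formulas \<open>\<chi> X\<close>: formulas that hold exactly in
  the empty team and in the teams that are \<open>X\<close> when restricted to \<open>N\<close>. A disjunction splits a
  team into pieces, so \<open>Disj \<X> \<chi>\<close> holds exactly in the unions of subcollections of \<open>\<X>\<close>, that
  is, in the members of \<open>\<X>\<close> (\<open>normal_form\<close>). It remains to see that the formulas of the two
  languages are characteristic. For inclusion atoms, \<open>Theta p n X\<close> bounds a team from above by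
  \<open>X\<close> and \<open>Phi p n X\<close> bounds a nonempty team from below by \<open>X\<close>. For inconstancy atoms one decides
  the variables one at a time: the two disjuncts in \<open>psi_rec\<close> contain \<open>q\<close> and \<open>\<not> q\<close>, so
  they can only be satisfied by splitting the team according to the value of \<open>q\<close>, and the atom
  \<open>Inconst q\<close> rules out that just one half is empty (\<open>sat_psi_rec_Suc\<close>).

  Teams over larger domains are compared through the value lists \<open>trace p n v\<close>. Restriction to
  \<open>N\<close> does not affect traces, and two teams have the same restriction to \<open>N\<close> exactly
  when they have the same set of traces.
\<close>

section \<open>Locality and union closure\<close>

lemma sat_empty: "sat \<phi> {}"
  by (induction \<phi>) auto

lemma ball_bex_Union:
  "(\<And>X. X \<in> S \<Longrightarrow> \<forall>v\<in>X. \<exists>u\<in>X. R v u) \<Longrightarrow> \<forall>v\<in>\<Union>S. \<exists>u\<in>\<Union>S. R v u"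
  by blast

text \<open>Negation quantifies over single valuations and the inclusion and anonymity atoms demand,
  for each valuation, a witness in the team; a witness survives in any larger team.\<close>

lemma sat_Union: "(\<And>X. X \<in> S \<Longrightarrow> sat \<phi> X) \<Longrightarrow> sat \<phi> (\<Union>S)"
proof (induction \<phi> arbitrary: S)
  case (Or \<phi> \<psi>)
  from Or.prems have "\<forall>X\<in>S. \<exists>Y Z. X = Y \<union> Z \<and> sat \<phi> Y \<and> sat \<psi> Z" by fastforce
  then obtain f g where fg: "\<And>X. X \<in> S \<Longrightarrow> X = f X \<union> g X \<and> sat \<phi> (f X) \<and> sat \<psi> (g X)"
    by metis
  have "sat \<phi> (\<Union>(f ` S))" "sat \<psi> (\<Union>(g ` S))"
    using fg by (auto intro!: Or.IH)
  moreover have "\<Union>S = \<Union>(f ` S) \<union> \<Union>(g ` S)" using fg by blast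
  ultimately show ?case by (metis sat.simps(6) sup_ge1 sup_ge2)
next
  case (Incl as bs)
  then show ?case unfolding sat.simps by (rule ball_bex_Union)
next
  case (Anon ps qs)
  then show ?case unfolding sat.simps by (rule ball_bex_Union)
qed auto

text \<open>Locality. The map \<open>f\<close> is any invariant of valuations that determines their values at the
  variables of the formula. For a disjunction, a splitting of \<open>X\<close> is transported to \<open>Y\<close> by taking
  preimages under \<open>f\<close>.\<close>

lemma sat_cong_image:
  assumes "\<And>v w q. q \<in> props \<phi> \<Longrightarrow> f v = f w \<Longrightarrow> v q = w q" and "f ` X = f ` Y"
  shows "sat \<phi> X \<longleftrightarrow> sat \<phi> Y"
proof -
  have transfer: "sat \<phi> Y"
    if "\<And>v w q. q \<in> props \<phi> \<Longrightarrow> f v = f w \<Longrightarrow> v q = w q" "f ` X = f ` Y" "sat \<phi> X"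
    for \<phi> X Y
    using that
  proof (induction \<phi> arbitrary: X Y)
    case (Var q)
    then show ?case by simp (metis (no_types, lifting) imageE imageI)
  next
    case (Neg \<phi>)
    have "\<not> sat \<phi> {w}" if "w \<in> Y" for w
    proof
      assume w: "sat \<phi> {w}"
      obtain v where "v \<in> X" "f v = f w" using Neg.prems(2) \<open>w \<in> Y\<close> by (metis imageE imageI)
      then have "sat \<phi> {v}" using Neg.IH[of "{w}" "{v}"] Neg.prems(1) w by simp
      then show False using Neg.prems(3) \<open>v \<in> X\<close> by simp
    qed
    then show ?case by simp
  next
    case (And \<phi> \<psi>)
    have "sat \<phi> Y" by (rule And.IH(1)[of X Y]) (use And.prems in auto)
    moreover have "sat \<psi> Y" by (rule And.IH(2)[of X Y]) (use And.prems in auto)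
    ultimately show ?case by simp
  next
    case (Or \<phi> \<psi>)
    from Or.prems(3) obtain X1 X2 where X: "X = X1 \<union> X2" "sat \<phi> X1" "sat \<psi> X2" by auto
    define Y1 where "Y1 = {y \<in> Y. f y \<in> f ` X1}"
    define Y2 where "Y2 = {y \<in> Y. f y \<in> f ` X2}"
    have "f ` {y \<in> Y. f y \<in> A} = A" if "A \<subseteq> f ` Y" for A
      using that by auto
    moreover have "f ` X1 \<subseteq> f ` Y" "f ` X2 \<subseteq> f ` Y"
      using Or.prems(2) X(1) by auto
    ultimately have images: "f ` X1 = f ` Y1" "f ` X2 = f ` Y2"
      unfolding Y1_def Y2_def by auto
    have "sat \<phi> Y1" by (rule Or.IH(1)[of X1 Y1]) (use Or.prems(1) images X in auto)
    moreover have "sat \<psi> Y2" by (rule Or.IH(2)[of X2 Y2]) (use Or.prems(1) images X in auto)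
    moreover have "f y \<in> f ` X1 \<or> f y \<in> f ` X2" if "y \<in> Y" for y
      using Or.prems(2) X(1) that by (metis UnE image_Un imageI)
    then have "Y = Y1 \<union> Y2"
      unfolding Y1_def Y2_def by (simp add: set_eq_iff) metis
    ultimately show ?case by auto
  next
    case (Incl as bs)
    have entry: "entry_val v a = entry_val w a" if "f v = f w" "a \<in> set as \<union> set bs" for v w a
      using Incl.prems(1)[of _ v w] that by (cases a) force+
    have "\<exists>u\<in>Y. map (entry_val w) as = map (entry_val u) bs" if "w \<in> Y" for w
    proof -
      obtain v where v: "v \<in> X" "f v = f w" using Incl.prems(2) \<open>w \<in> Y\<close> by (metis imageE imageI)
      obtain u where u: "u \<in> X" "map (entry_val v) as = map (entry_val u) bs"
        using Incl.prems(3) v(1) unfolding sat.simps by meson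
      obtain u' where u': "u' \<in> Y" "f u = f u'" using Incl.prems(2) u(1) by (metis imageE imageI)
      have "map (entry_val w) as = map (entry_val v) as"
        "map (entry_val u) bs = map (entry_val u') bs"
        using v(2) u'(2) by (intro map_cong refl entry; simp)+
      then show ?thesis using u(2) u'(1) by metis
    qed
    then show ?case by simp
  next
    case (Anon ps qs)
    have agree: "v q = w q" if "f v = f w" "q \<in> set ps \<union> set qs" for v w q
      using Anon.prems(1)[of q v w] that by simp
    have "\<exists>u\<in>Y. map w ps = map u ps \<and> map w qs \<noteq> map u qs" if "w \<in> Y" for w
    proof -
      obtain v where v: "v \<in> X" "f v = f w" using Anon.prems(2) \<open>w \<in> Y\<close> by (metis imageE imageI)
      obtain u where u: "u \<in> X" "map v ps = map u ps" "map v qs \<noteq> map u qs"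
        using Anon.prems(3) v(1) unfolding sat.simps by meson
      obtain u' where u': "u' \<in> Y" "f u = f u'" using Anon.prems(2) u(1) by (metis imageE imageI)
      have eqs: "map w ps = map v ps" "map u ps = map u' ps" "map w qs = map v qs" "map u qs = map u' qs"
        using v(2) u'(2) by (simp_all add: agree[of v w] agree[of u u'])
      have "map w ps = map u' ps" "map w qs \<noteq> map u' qs"
        using u(2,3) unfolding eqs .
      then show ?thesis using u'(1) by blast
    qed
    then show ?case by simp
  qed auto
  from assms show ?thesis using transfer[of \<phi> X Y] transfer[of \<phi> Y X] by metis
qed

section \<open>Finite conjunctions and disjunctions\<close>

lemma set_list_of:
  assumes "finite A"
  shows "set (list_of A) = A"
proof -
  have "\<exists>xs. distinct xs \<and> set xs = A" using finite_distinct_list[OF assms] by blast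
  from someI_ex[OF this] show ?thesis by (simp add: list_of_def)
qed

lemma sat_conj_list: "sat (conj_list \<phi>s) X \<longleftrightarrow> (\<forall>\<phi>\<in>set \<phi>s. sat \<phi> X)"
  by (induction \<phi>s rule: conj_list.induct) auto

lemma sat_Conj: "finite A \<Longrightarrow> sat (Conj A f) X \<longleftrightarrow> (\<forall>a\<in>A. sat (f a) X)"
  by (simp add: Conj_def sat_conj_list set_list_of)

text \<open>An entry that occurs twice in the list receives two pieces of the team; by closure under unions
  they can be merged, so the pieces can be indexed by the set of entries.\<close>

lemma sat_disj_list:
  "sat (disj_list (map f as)) X \<longleftrightarrow>
    (\<exists>P. X = (\<Union>a\<in>set as. P a) \<and> (\<forall>a\<in>set as. sat (f a) (P a)))"
proof (induction as arbitrary: X rule: induct_list012)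
  case 1
  then show ?case by simp
next
  case (2 a)
  then show ?case by auto
next
  case (3 a b as)
  let ?bs = "b # as"
  have "sat (disj_list (map f (a # ?bs))) X \<longleftrightarrow>
      (\<exists>Y Z. X = Y \<union> Z \<and> sat (f a) Y \<and> sat (disj_list (map f ?bs)) Z)"
    by auto
  also have "\<dots> \<longleftrightarrow> (\<exists>P. X = (\<Union>c\<in>set (a # ?bs). P c) \<and> (\<forall>c\<in>set (a # ?bs). sat (f c) (P c)))"
  proof
    assume "\<exists>Y Z. X = Y \<union> Z \<and> sat (f a) Y \<and> sat (disj_list (map f ?bs)) Z"
    then obtain Y Z P where P: "X = Y \<union> Z" "sat (f a) Y" "Z = (\<Union>c\<in>set ?bs. P c)"
      "\<forall>c\<in>set ?bs. sat (f c) (P c)"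
      unfolding 3 by blast
    define Q where "Q c = (if c = a then Y else {}) \<union> (if c \<in> set ?bs then P c else {})" for c
    have "sat (f c) (Q c)" if "c \<in> set (a # ?bs)" for c
    proof -
      have "sat (f c) (\<Union>{if c = a then Y else {}, if c \<in> set ?bs then P c else {}})"
        by (rule sat_Union) (use P sat_empty in \<open>auto split: if_splits\<close>)
      then show ?thesis by (simp add: Q_def)
    qed
    moreover have "X = (\<Union>c\<in>set (a # ?bs). Q c)"
      unfolding P(1,3) Q_def by (auto split: if_splits)
    ultimately show "\<exists>P. X = (\<Union>c\<in>set (a # ?bs). P c) \<and> (\<forall>c\<in>set (a # ?bs). sat (f c) (P c))"
      by blast
  next
    assume "\<exists>P. X = (\<Union>c\<in>set (a # ?bs). P c) \<and> (\<forall>c\<in>set (a # ?bs). sat (f c) (P c))"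
    then obtain P where "X = P a \<union> (\<Union>c\<in>set ?bs. P c)" "\<forall>c\<in>set (a # ?bs). sat (f c) (P c)"
      by auto
    then show "\<exists>Y Z. X = Y \<union> Z \<and> sat (f a) Y \<and> sat (disj_list (map f ?bs)) Z"
      unfolding 3 by (metis list.set_intros)
  qed
  finally show ?case .
qed

lemma sat_Disj:
  "finite A \<Longrightarrow>
    sat (Disj A f) X \<longleftrightarrow> (\<exists>P. X = (\<Union>a\<in>A. P a) \<and> (\<forall>a\<in>A. sat (f a) (P a)))"
  by (simp add: Disj_def sat_disj_list set_list_of)

section \<open>Disjunctions of characteristic formulas\<close>

definition trace :: "(nat \<Rightarrow> 'p) \<Rightarrow> nat \<Rightarrow> 'p valuation \<Rightarrow> bool list" where
  "trace p n v = map (\<lambda>i. v (p i)) [1..<Suc n]"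

lemma trace_eq_iff: "trace p n v = trace p n w \<longleftrightarrow> (\<forall>i\<in>{1..n}. v (p i) = w (p i))"
  by (auto simp: trace_def)

text \<open>The collection consists of all \<open>N\<close>-teams that satisfy \<open>\<phi>\<close>. The characteristic property of
  \<open>\<chi> X\<close> is required for sets of valuations over arbitrary domains; with locality this covers all
  the teams that semantic equivalence refers to.\<close>

lemma normal_form:
  assumes "finite N" "N = p ` {1..n}" and "props \<phi> \<subseteq> N"
    and \<chi>: "\<And>X Y. team N X \<Longrightarrow> sat (\<chi> X) Y \<longleftrightarrow> Y = {} \<or> trace p n ` Y = trace p n ` X"
  shows "\<exists>\<X>. (\<forall>X\<in>\<X>. team N X) \<and> sem_equiv \<phi> (Disj \<X> \<chi>)"
proof -
  define \<X> where "\<X> = {X. team N X \<and> sat \<phi> X}"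
  have "\<X> \<subseteq> Pow (valuations N)" by (auto simp: \<X>_def team_def)
  moreover have "finite (valuations N)"
    using \<open>finite N\<close> by (auto simp: valuations_def intro!: finite_PiE)
  ultimately have fin: "finite \<X>" by (meson finite_Pow_iff finite_subset)
  have local: "sat \<phi> X \<longleftrightarrow> sat \<phi> Y" if "trace p n ` X = trace p n ` Y" for X Y
    using that assms(2,3) by (intro sat_cong_image[of _ "trace p n"]) (auto simp: trace_eq_iff)
  have "sat \<phi> Y \<longleftrightarrow> sat (Disj \<X> \<chi>) Y" for Y
  proof
    assume sat: "sat \<phi> Y"
    define X where "X = (\<lambda>v. restrict v N) ` Y"
    have tr: "trace p n ` Y = trace p n ` X"
      using assms(2) by (auto simp: X_def image_image trace_def intro!: image_cong)
    have X: "team N X" by (auto simp: X_def team_def valuations_def)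
    have "X \<in> \<X>" using X sat local[OF tr] by (simp add: \<X>_def)
    \<comment> \<open>The whole team goes to the disjunct of its restriction; all other pieces are empty.\<close>
    moreover define P where "P Z = (if Z = X then Y else {})" for Z
    ultimately have "Y = (\<Union>Z\<in>\<X>. P Z)" "\<forall>Z\<in>\<X>. sat (\<chi> Z) (P Z)"
      using \<chi>[OF X] tr by (auto simp: sat_empty)
    then show "sat (Disj \<X> \<chi>) Y" unfolding sat_Disj[OF fin] by blast
  next
    assume "sat (Disj \<X> \<chi>) Y"
    then obtain P where Y: "Y = \<Union>(P ` \<X>)" and P: "\<And>X. X \<in> \<X> \<Longrightarrow> sat (\<chi> X) (P X)"
      unfolding sat_Disj[OF fin] by blast
    have "sat \<phi> (P X)" if "X \<in> \<X>" for X
    proof -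
      have "P X = {} \<or> trace p n ` P X = trace p n ` X"
        using \<chi> P[OF that] that by (simp add: \<X>_def)
      then show ?thesis using local[of "P X" X] that sat_empty by (auto simp: \<X>_def)
    qed
    then show "sat \<phi> Y" unfolding Y by (auto intro: sat_Union)
  qed
  then have "sem_equiv \<phi> (Disj \<X> \<chi>)" unfolding sem_equiv_def by blast
  moreover have "\<forall>X\<in>\<X>. team N X" by (simp add: \<X>_def)
  ultimately show ?thesis by blast
qed

section \<open>Characteristic formulas from inclusion atoms\<close>

lemma sat_lit: "sat (lit q b) Y \<longleftrightarrow> (\<forall>y\<in>Y. y q = b)"
  by (cases b) (simp_all add: lit_def)

lemma sat_Theta:
  assumes "finite X"
  shows "sat (Theta p n X) Y \<longleftrightarrow> trace p n ` Y \<subseteq> trace p n ` X"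
proof -
  have lits: "sat (conj_list (map (\<lambda>i. lit (p i) (v (p i))) [1..<Suc n])) Z \<longleftrightarrow>
      (\<forall>y\<in>Z. trace p n y = trace p n v)" for v Z
    unfolding sat_conj_list by (auto simp: sat_lit trace_eq_iff)
  have "sat (Theta p n X) Y \<longleftrightarrow>
      (\<exists>P. Y = (\<Union>v\<in>X. P v) \<and> (\<forall>v\<in>X. \<forall>y\<in>P v. trace p n y = trace p n v))"
    unfolding Theta_def sat_Disj[OF assms] lits ..
  also have "\<dots> \<longleftrightarrow> trace p n ` Y \<subseteq> trace p n ` X"
  proof
    assume "trace p n ` Y \<subseteq> trace p n ` X"
    then have "Y = (\<Union>v\<in>X. {y \<in> Y. trace p n y = trace p n v})" by auto
    then show "\<exists>P. Y = (\<Union>v\<in>X. P v) \<and> (\<forall>v\<in>X. \<forall>y\<in>P v. trace p n y = trace p n v)"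
      by (intro exI[of _ "\<lambda>v. {y \<in> Y. trace p n y = trace p n v}"]) auto
  qed auto
  finally show ?thesis .
qed

lemma sat_Phi:
  assumes "finite X"
  shows "sat (Phi p n X) Y \<longleftrightarrow> Y = {} \<or> trace p n ` X \<subseteq> trace p n ` Y"
proof -
  have const: "entry_val y (const b) = b" for y :: "'a valuation" and b
    by (simp add: const_def)
  have "sat (Phi p n X) Y \<longleftrightarrow> (\<forall>v\<in>X. \<forall>y\<in>Y. \<exists>u\<in>Y. trace p n v = trace p n u)"
    unfolding Phi_def sat_Conj[OF assms] trace_def by (simp add: const comp_def del: upt_Suc)
  then show ?thesis by auto
qed

section \<open>Characteristic formulas from inconstancy atoms\<close>

lemma sat_Inconst:
  "sat (Inconst q) Y \<longleftrightarrow> Y = {} \<or> ({v \<in> Y. v q} \<noteq> {} \<and> {v \<in> Y. \<not> v q} \<noteq> {})"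
  by auto

text \<open>A piece satisfying the first disjunct lies inside \<open>{v. v q}\<close> and one satisfying the second
  lies outside, so there is only one candidate for the splitting.\<close>

lemma sat_Or_complementary:
  "sat (Or (And \<phi> (Var q)) (And \<psi> (Neg (Var q)))) Y \<longleftrightarrow>
    sat \<phi> {v \<in> Y. v q} \<and> sat \<psi> {v \<in> Y. \<not> v q}"
proof
  assume "sat (Or (And \<phi> (Var q)) (And \<psi> (Neg (Var q)))) Y"
  then obtain A B where AB: "Y = A \<union> B" "sat \<phi> A" "\<forall>v\<in>A. v q" "sat \<psi> B" "\<forall>v\<in>B. \<not> v q"
    by auto
  then have "{v \<in> Y. v q} = A" "{v \<in> Y. \<not> v q} = B" by auto
  with AB show "sat \<phi> {v \<in> Y. v q} \<and> sat \<psi> {v \<in> Y. \<not> v q}" by simp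
next
  assume "sat \<phi> {v \<in> Y. v q} \<and> sat \<psi> {v \<in> Y. \<not> v q}"
  moreover have "Y = {v \<in> Y. v q} \<union> {v \<in> Y. \<not> v q}" by auto
  ultimately show "sat (Or (And \<phi> (Var q)) (And \<psi> (Neg (Var q)))) Y" by auto
qed

text \<open>A uniform description of the recursion that also covers its start at one variable, where
  \<open>psi_rec p 0\<close> is the trivially true formula.\<close>

lemma sat_psi_rec_Suc:
  fixes p :: "nat \<Rightarrow> 'p" and X Y :: "'p valuation set" and m :: nat
  defines "q \<equiv> p (Suc m)"
  defines "pos Z \<equiv> {v \<in> Z. v q}" and "neg Z \<equiv> {v \<in> Z. \<not> v q}"
  assumes "X \<noteq> {}"
  shows "sat (psi_rec p (Suc m) X) Y \<longleftrightarrow> Y = {} \<or>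
    ((pos Y = {} \<longleftrightarrow> pos X = {}) \<and> (neg Y = {} \<longleftrightarrow> neg X = {}) \<and>
     sat (if pos X = {} then Top else psi_rec p m (pos X)) (pos Y) \<and>
     sat (if neg X = {} then Top else psi_rec p m (neg X)) (neg Y))"
proof (cases "Y = {}")
  case True
  then show ?thesis by (simp add: sat_empty)
next
  case False
  have split: "Z = pos Z \<union> neg Z" for Z by (auto simp: pos_def neg_def)
  have var: "sat (Var q) Y \<longleftrightarrow> neg Y = {}" "sat (Neg (Var q)) Y \<longleftrightarrow> pos Y = {}"
    by (auto simp: pos_def neg_def)
  have inconst: "sat (Inconst q) Y \<longleftrightarrow> pos Y \<noteq> {} \<and> neg Y \<noteq> {}"
    using False unfolding sat_Inconst pos_def neg_def by simp
  have step: "sat (psi_rec p (Suc m) X) Y \<longleftrightarrow>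
      sat (if pos X = {} then And (psi_rec p m (neg X)) (Neg (Var q))
        else if neg X = {} then And (psi_rec p m (pos X)) (Var q)
        else And (Or (And (psi_rec p m (pos X)) (Var q)) (And (psi_rec p m (neg X)) (Neg (Var q))))
          (Inconst q)) Y"
  proof (cases m)
    case 0
    have "psi_rec p (Suc 0) X =
        (if pos X = {} then Neg (Var q) else if neg X = {} then Var q
         else And (Or (Var q) (Neg (Var q))) (Inconst q))"
      by (simp only: psi_rec.simps(2) Let_def pos_def neg_def q_def 0 One_nat_def)
    moreover have "sat (Or (Var q) (Neg (Var q))) Y \<longleftrightarrow>
        sat (Or (And Top (Var q)) (And Top (Neg (Var q)))) Y"
      by simp
    ultimately show ?thesis
      unfolding 0 by (simp del: psi_rec.simps(2) sat.simps(1,4,6,8))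
  next
    case (Suc l)
    then show ?thesis by (simp only: psi_rec.simps(3) Let_def pos_def neg_def q_def)
  qed
  consider "pos X = {}" "neg X \<noteq> {}" | "pos X \<noteq> {}" "neg X = {}" | "pos X \<noteq> {}" "neg X \<noteq> {}"
    using split[of X] \<open>X \<noteq> {}\<close> by blast
  then show ?thesis
  proof cases
    case 1
    have "pos Y = {} \<Longrightarrow> neg Y = Y" using split[of Y] by simp
    then show ?thesis using 1 False by (auto simp: step var simp del: sat.simps(1,4,6,8))
  next
    case 2
    have "neg Y = {} \<Longrightarrow> pos Y = Y" using split[of Y] by simp
    then show ?thesis using 2 False by (auto simp: step var simp del: sat.simps(1,4,6,8))
  next
    case 3
    have "sat (Or (And \<phi> (Var q)) (And \<psi> (Neg (Var q)))) Y \<longleftrightarrow> sat \<phi> (pos Y) \<and> sat \<psi> (neg Y)"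
      for \<phi> \<psi>
      unfolding sat_Or_complementary pos_def neg_def ..
    then show ?thesis
      using 3 False by (auto simp: step inconst simp del: sat.simps(1,4,6,8))
  qed
qed

text \<open>The counterpart for traces of the recursion of \<open>psi_rec\<close>: the last entry of a trace tells
  apart the two halves of a team.\<close>

lemma trace_image_Suc_eq_iff:
  "trace p (Suc m) ` Y = trace p (Suc m) ` X \<longleftrightarrow>
    trace p m ` {v \<in> Y. v (p (Suc m))} = trace p m ` {v \<in> X. v (p (Suc m))} \<and>
    trace p m ` {v \<in> Y. \<not> v (p (Suc m))} = trace p m ` {v \<in> X. \<not> v (p (Suc m))}"
proof -
  have split: "trace p (Suc m) ` Z =
      (\<lambda>t. t @ [True]) ` trace p m ` {v \<in> Z. v (p (Suc m))} \<union>
      (\<lambda>t. t @ [False]) ` trace p m ` {v \<in> Z. \<not> v (p (Suc m))}" for Z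
  proof -
    have "trace p (Suc m) v = trace p m v @ [v (p (Suc m))]" for v
      by (simp add: trace_def)
    moreover have "Z = {v \<in> Z. v (p (Suc m))} \<union> {v \<in> Z. \<not> v (p (Suc m))}"
      by auto
    ultimately show ?thesis
      by (subst \<open>Z = _\<close>, unfold image_Un image_image)
        (auto intro!: arg_cong2[of _ _ _ _ "(\<union>)"] image_cong)
  qed
  have inj: "(\<lambda>t. t @ [True]) ` A \<union> (\<lambda>t. t @ [False]) ` B =
      (\<lambda>t. t @ [True]) ` A' \<union> (\<lambda>t. t @ [False]) ` B' \<longleftrightarrow> A = A' \<and> B = B'"
    for A A' B B' :: "bool list set"
    by (auto simp: set_eq_iff image_iff)
  show ?thesis unfolding split inj ..
qed

lemma sat_psi_rec:
  "X \<noteq> {} \<Longrightarrow> sat (psi_rec p m X) Y \<longleftrightarrow> Y = {} \<or> trace p m ` Y = trace p m ` X"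
proof (induction m arbitrary: X Y)
  case 0
  then show ?case by (auto simp: trace_def)
next
  case (Suc m)
  have half: "(B = {} \<longleftrightarrow> A = {}) \<and> sat (if A = {} then Top else psi_rec p m A) B \<longleftrightarrow>
      trace p m ` B = trace p m ` A" for A B
    using Suc.IH[of A B] by auto
  show ?case
    unfolding sat_psi_rec_Suc[OF Suc.prems] trace_image_Suc_eq_iff half[symmetric] by blast
qed

lemma sat_psi: "sat (psi p n X) Y \<longleftrightarrow> Y = {} \<or> trace p n ` Y = trace p n ` X"
  by (cases "X = {}") (auto simp: psi_def sat_psi_rec)

section \<open>The normal forms\<close>

theorem corollary3p8:
  fixes p :: "nat \<Rightarrow> 'p" and n :: nat and N :: "'p set"
  assumes "inj_on p {1..n}" and "N = p ` {1..n}"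
  shows
    "(\<forall>\<phi> \<in> CPL_incl0 \<union> CPL_incl. props \<phi> \<subseteq> N \<longrightarrow>
        (\<exists>\<X>. (\<forall>X\<in>\<X>. team N X) \<and>
             sem_equiv \<phi> (Disj \<X> (\<lambda>X. And (Theta p n X) (Phi p n X))))) \<and>
     (\<forall>\<phi> \<in> CPL_inconst \<union> CPL_anon. props \<phi> \<subseteq> N \<longrightarrow>
        (\<exists>\<X>. (\<forall>X\<in>\<X>. team N X) \<and> sem_equiv \<phi> (Disj \<X> (psi p n))))"
proof -
  have "finite N" using assms(2) by simp
  have Theta_Phi: "sat (And (Theta p n X) (Phi p n X)) Y \<longleftrightarrow>
      Y = {} \<or> trace p n ` Y = trace p n ` X" if "team N X" for X Y
  proof -
    have "finite (valuations N)"
      using \<open>finite N\<close> by (auto simp: valuations_def intro!: finite_PiE)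
    then have "finite X" using that by (auto simp: team_def intro: finite_subset)
    then show ?thesis by (auto simp: sat_Theta sat_Phi)
  qed
  show ?thesis
    using normal_form[OF \<open>finite N\<close> assms(2) _ Theta_Phi]
      normal_form[OF \<open>finite N\<close> assms(2) _ sat_psi]
    by blast
qed

end
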